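(* Let $G$ be a graph of order $n\geq 4$ with complement $\overline{G}$. If both $G$ and $\overline{G}$ are connected, then $tpc(G)+tpc(\overline{G})\geq 6$. Moreover, this lower bound is sharp: for every $n\geq 4$ there exists a graph $G$ of order $n$ such that both $G$ and $\overline{G}$ are connected and $tpc(G)+tpc(\overline{G})=6$.
   Context: All graphs are simple, finite and undirected. A total-coloring of a graph $G$ assigns a color to every vertex and every edge of $G$ (with no properness requirement). A path $P$ in a total-colored graph is a total-proper path if (i) any two adjacent edges of $P$ have distinct colors; (ii) any two adjacent internal vertices of $P$ have distinct colors; (iii) any internal vertex of $P$ has a color distinct from the colors of its incident edges of $P$. The total-colored graph $G$ is total-proper connected if any two distinct vertices of $G$ are connected by a total-proper path. For a nontrivial connected graph $G$, the total-proper connection number $tpc(G)$ is the minimum number of colors in a total-coloring that makes $G$ total-proper connected. *)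

theory Defs
  imports Main
begin

text \<open>A graph is a pair of a vertex set and a set of undirected edges, an edge being the
  set of its two endpoints.\<close>

type_synonym 'a graph = "'a set \<times> 'a set set"

abbreviation verts :: "'a graph \<Rightarrow> 'a set" where
  "verts G \<equiv> fst G"

abbreviation edges :: "'a graph \<Rightarrow> 'a set set" where
  "edges G \<equiv> snd G"

definition simple_graph :: "'a graph \<Rightarrow> bool" where
  "simple_graph G \<longleftrightarrow>
     finite (verts G) \<and> edges G \<subseteq> {e. e \<subseteq> verts G \<and> card e = 2}"

definition complement :: "'a graph \<Rightarrow> 'a graph" where
  "complement G = (verts G, {e. e \<subseteq> verts G \<and> card e = 2} - edges G)"

definition is_path :: "'a graph \<Rightarrow> 'a list \<Rightarrow> bool" where
  "is_path G p \<longleftrightarrow>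
     p \<noteq> [] \<and> distinct p \<and> set p \<subseteq> verts G \<and>
     (\<forall>i. i + 1 < length p \<longrightarrow> {p ! i, p ! (i + 1)} \<in> edges G)"

definition connected_graph :: "'a graph \<Rightarrow> bool" where
  "connected_graph G \<longleftrightarrow>
     verts G \<noteq> {} \<and>
     (\<forall>u\<in>verts G. \<forall>v\<in>verts G. \<exists>p. is_path G p \<and> hd p = u \<and> last p = v)"

text \<open>A total-coloring is a function on the disjoint sum of vertices (\<open>Inl\<close>) and edges
  (\<open>Inr\<close>), relevant only on \<open>verts G <+> edges G\<close>. Since graphs are finite, natural numbers
  suffice as colors.\<close>

type_synonym 'a total_coloring = "'a + 'a set \<Rightarrow> nat"

text \<open>The internal vertices of a path \<open>p\<close> are the \<open>p ! i\<close> with \<open>0 < i\<close> and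
  \<open>i + 1 < length p\<close>. Adjacency of edges and of internal vertices is adjacency in the path.\<close>

definition total_proper_path :: "'a graph \<Rightarrow> 'a total_coloring \<Rightarrow> 'a list \<Rightarrow> bool" where
  "total_proper_path G c p \<longleftrightarrow>
     is_path G p \<and>
     (\<forall>i. i + 2 < length p \<longrightarrow>
        c (Inr {p ! i, p ! (i + 1)}) \<noteq> c (Inr {p ! (i + 1), p ! (i + 2)})) \<and>
     (\<forall>i. 0 < i \<and> i + 2 < length p \<longrightarrow> c (Inl (p ! i)) \<noteq> c (Inl (p ! (i + 1)))) \<and>
     (\<forall>i. i + 2 < length p \<longrightarrow>
        c (Inl (p ! (i + 1))) \<noteq> c (Inr {p ! i, p ! (i + 1)}) \<and>
        c (Inl (p ! (i + 1))) \<noteq> c (Inr {p ! (i + 1), p ! (i + 2)}))"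

definition total_proper_connected :: "'a graph \<Rightarrow> 'a total_coloring \<Rightarrow> bool" where
  "total_proper_connected G c \<longleftrightarrow>
     (\<forall>u\<in>verts G. \<forall>v\<in>verts G. u \<noteq> v \<longrightarrow>
        (\<exists>p. total_proper_path G c p \<and> hd p = u \<and> last p = v))"

text \<open>For a finite connected graph the set minimised over is nonempty, because a coloring
  that is injective on \<open>verts G <+> edges G\<close> makes every path total-proper.\<close>

definition tpc :: "'a graph \<Rightarrow> nat" where
  "tpc G = (LEAST k. \<exists>c. total_proper_connected G c \<and> card (c ` (verts G <+> edges G)) = k)"

end

theory Submission
  imports Defs
begin

text \<open>A path joining two non-adjacent vertices has an internal vertex. That vertex and its two
  incident path edges carry three distinct colors, so \<^const>\<open>tpc\<close> is at least 3 for every connected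
  graph that is not complete. When a graph and its complement are both connected on at least two
  vertices, each of them has an edge, hence neither is complete, and the two numbers add up to at
  least 6 (\<open>tpc_ge_3\<close>, \<open>connected_graph_has_edge\<close>).

  For sharpness it is enough that both graphs have a Hamiltonian path. Walk along such a path and
  color its vertices and edges, in the order in which they are met, with 0, 1, 2, 0, 1, 2, and so on.
  The conditions on a total-proper path only compare objects at distance one or two in this order,
  so every segment of the path is total-proper, and three colors suffice
  (\<open>hamiltonian_path_tpc_le_3\<close>). The path on \<open>n\<close> vertices is trivially Hamiltonian. In its
  complement one visits the odd vertices in increasing order and then the even ones: all
  jumps have length two except the middle one, which leads from the largest odd vertex to 0 and
  avoids the edge from 1 to 0 precisely because \<open>n \<ge> 4\<close>.\<close>

section \<open>The lower bound\<close>

lemma simple_graph_complement: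
  "simple_graph G \<Longrightarrow> simple_graph (complement G)"
  by (auto simp: simple_graph_def complement_def)

lemma finite_edges:
  assumes "simple_graph G"
  shows "finite (edges G)"
proof (rule finite_subset)
  show "edges G \<subseteq> Pow (verts G)"
    using assms by (auto simp: simple_graph_def)
  show "finite (Pow (verts G))"
    using assms by (simp add: simple_graph_def)
qed

text \<open>An injective coloring makes every path total-proper. Without such a coloring the \<open>LEAST\<close> in
  the definition of \<^const>\<open>tpc\<close> would range over an empty set and be unspecified.\<close>

lemma ex_total_proper_connected:
  assumes G: "simple_graph G" and conn: "connected_graph G"
  shows "\<exists>c. total_proper_connected G c"
proof -
  have "finite (verts G <+> edges G)"
    using G finite_edges[OF G] by (simp add: simple_graph_def)
  from finite_imp_inj_to_nat_seg[OF this]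
  obtain c :: "'a total_coloring" where inj: "inj_on c (verts G <+> edges G)"
    by auto
  have proper: "total_proper_path G c p" if p: "is_path G p" for p
  proof -
    have V: "p ! i \<in> verts G" if "i < length p" for i
      using p that by (auto simp: is_path_def)
    have E: "{p ! i, p ! (i + 1)} \<in> edges G" if "i + 1 < length p" for i
      using p that by (auto simp: is_path_def)
    have D: "p ! i = p ! j \<longleftrightarrow> i = j" if "i < length p" "j < length p" for i j
      using p that by (auto simp: is_path_def nth_eq_iff_index_eq)
    have edge_ne: "c (Inr {p ! i, p ! (i + 1)}) \<noteq> c (Inr {p ! (i + 1), p ! (i + 2)})"
      if "i + 2 < length p" for i
    proof -
      have "{p ! i, p ! (i + 1)} \<noteq> {p ! (i + 1), p ! (i + 2)}"
        using that by (simp add: doubleton_eq_iff D)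
      moreover have "{p ! i, p ! (i + 1)} \<in> edges G" "{p ! (i + 1), p ! (i + 2)} \<in> edges G"
        using E[of i] E[of "i + 1"] that by simp_all
      ultimately show ?thesis
        by (simp add: inj_on_eq_iff[OF inj] InrI)
    qed
    have vertex_ne: "c (Inl (p ! i)) \<noteq> c (Inl (p ! (i + 1)))" if "i + 2 < length p" for i
      using that by (simp add: inj_on_eq_iff[OF inj] InlI V D)
    have mixed_ne: "c (Inl (p ! (i + 1))) \<noteq> c (Inr {p ! i, p ! (i + 1)})"
      "c (Inl (p ! (i + 1))) \<noteq> c (Inr {p ! (i + 1), p ! (i + 2)})"
      if "i + 2 < length p" for i
      using V[of "i + 1"] E[of i] E[of "i + 1"] that
      by (simp_all add: inj_on_eq_iff[OF inj] InlI InrI)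
    show ?thesis
      unfolding total_proper_path_def using p edge_ne vertex_ne mixed_ne by blast
  qed
  show ?thesis
    using conn proper unfolding connected_graph_def total_proper_connected_def by blast
qed

lemma tpc_ge_3:
  assumes G: "simple_graph G" and conn: "connected_graph G"
    and uv: "u \<in> verts G" "v \<in> verts G" "u \<noteq> v" "{u, v} \<notin> edges G"
  shows "3 \<le> tpc G"
proof -
  let ?P = "\<lambda>k. \<exists>c. total_proper_connected G c \<and> card (c ` (verts G <+> edges G)) = k"
  have "?P (tpc G)"
    unfolding tpc_def by (rule LeastI_ex) (use ex_total_proper_connected[OF G conn] in blast)
  then obtain c where c: "total_proper_connected G c"
    and card_c: "card (c ` (verts G <+> edges G)) = tpc G"
    by blast
  obtain p where p: "total_proper_path G c p" "hd p = u" "last p = v"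
    using c uv unfolding total_proper_connected_def by blast
  have path: "is_path G p"
    using p(1) by (simp add: total_proper_path_def)
  have long: "2 < length p"
  proof (rule ccontr)
    assume "\<not> 2 < length p"
    then consider "p = []" | "length p = 1" | "length p = 2"
      by (metis One_nat_def length_0_conv less_2_cases linorder_neqE_nat)
    then show False
    proof cases
      case 1
      then show ?thesis using path by (simp add: is_path_def)
    next
      case 2
      then show ?thesis using p uv by (auto simp: length_Suc_conv)
    next
      case 3
      then have "p = [u, v]"
        using p by (auto simp: numeral_2_eq_2 length_Suc_conv)
      then show ?thesis
        using path uv by (auto simp: is_path_def)
    qed
  qed
  let ?S = "{Inl (p ! 1), Inr {p ! 0, p ! 1}, Inr {p ! 1, p ! 2}}"
  have "p ! 1 \<in> verts G"
    using path long by (auto simp: is_path_def)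
  moreover have "{p ! 0, p ! 1} \<in> edges G" "{p ! 1, p ! 2} \<in> edges G"
    using path long by (auto simp: is_path_def numeral_2_eq_2)
  ultimately have sub: "c ` ?S \<subseteq> c ` (verts G <+> edges G)"
    by blast
  have "c (Inr {p ! 0, p ! 1}) \<noteq> c (Inr {p ! 1, p ! 2})"
    "c (Inl (p ! 1)) \<noteq> c (Inr {p ! 0, p ! 1})" "c (Inl (p ! 1)) \<noteq> c (Inr {p ! 1, p ! 2})"
    using p(1) long unfolding total_proper_path_def
    by (auto simp: numeral_2_eq_2 dest: spec[where x = 0])
  then have "card (c ` ?S) = 3"
    by simp
  moreover have "finite (c ` (verts G <+> edges G))"
    using G finite_edges[OF G] by (simp add: simple_graph_def)
  ultimately show ?thesis
    using card_mono[OF _ sub] card_c by simp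
qed

lemma connected_graph_has_edge:
  assumes conn: "connected_graph G" and u: "u \<in> verts G" and v: "v \<in> verts G" and "u \<noteq> v"
  shows "\<exists>e. e \<in> edges G"
proof -
  obtain p where p: "is_path G p" "hd p = u" "last p = v"
    using conn u v unfolding connected_graph_def by blast
  then have "1 < length p"
    using \<open>u \<noteq> v\<close> by (cases p) (auto simp: is_path_def)
  then show ?thesis
    using p(1) unfolding is_path_def by (auto dest: spec[where x = 0])
qed

text \<open>An edge of either graph joins two vertices that are not adjacent in the other. The relation
  between the two graphs is symmetric, so the lemma also bounds \<open>tpc H\<close>, and with \<open>H\<close> the complement
  of \<open>G\<close> no double complement has to be computed.\<close>

lemma tpc_ge_3_of_disjoint_connected:
  assumes "simple_graph G" "connected_graph G"
    and "simple_graph H" "connected_graph H"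
    and same: "verts H = verts G" and disj: "edges G \<inter> edges H = {}"
    and card: "2 \<le> card (verts G)"
  shows "3 \<le> tpc G"
proof -
  obtain u v where "u \<in> verts G" "v \<in> verts G" "u \<noteq> v"
    using card by (auto simp: card_le_Suc_iff numeral_2_eq_2)
  then obtain e where e: "e \<in> edges H"
    using connected_graph_has_edge assms(4) same by metis
  then have "e \<subseteq> verts G" "card e = 2"
    using assms(3) same by (auto simp: simple_graph_def)
  then obtain x y where "e = {x, y}" "x \<noteq> y" "x \<in> verts G" "y \<in> verts G"
    by (auto simp: card_2_iff)
  then show ?thesis
    using tpc_ge_3[OF assms(1,2)] e disj by blast
qed

lemma tpc_and_complement_ge_3:
  assumes G: "simple_graph G" and "connected_graph G" "connected_graph (complement G)"
    and "2 \<le> card (verts G)"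
  shows "3 \<le> tpc G" "3 \<le> tpc (complement G)"
proof -
  have "verts (complement G) = verts G" "edges G \<inter> edges (complement G) = {}"
    by (auto simp: complement_def)
  then show "3 \<le> tpc G" "3 \<le> tpc (complement G)"
    using assms simple_graph_complement[OF G]
    by (auto intro: tpc_ge_3_of_disjoint_connected[of G "complement G"]
        tpc_ge_3_of_disjoint_connected[of "complement G" G])
qed

section \<open>Graphs with a Hamiltonian path\<close>

text \<open>If \<open>pos\<close> numbers the vertices along a Hamiltonian path, the vertex at position \<open>i\<close> is the
  object number \<open>2 * i\<close> of the walk and the path edge from position \<open>i\<close> to \<open>i + 1\<close> is the object
  number \<open>2 * i + 1\<close>. Writing the latter as the sum of the two positions gives a color to the edges
  outside the path too, and makes the rule insensitive to the direction of travel.\<close>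

definition walk_coloring :: "('a \<Rightarrow> nat) \<Rightarrow> 'a total_coloring" where
  "walk_coloring pos x =
     (case x of Inl v \<Rightarrow> 2 * pos v mod 3 | Inr e \<Rightarrow> (\<Sum>v\<in>e. pos v) mod 3)"

lemma walk_coloring_Inl: "walk_coloring pos (Inl v) = 2 * pos v mod 3"
  by (simp add: walk_coloring_def)

lemma walk_coloring_edge:
  "u \<noteq> v \<Longrightarrow> walk_coloring pos (Inr {u, v}) = (pos u + pos v) mod 3"
  by (simp add: walk_coloring_def)

lemma card_walk_coloring_image_le: "card (walk_coloring pos ` A) \<le> 3"
proof -
  have "walk_coloring pos ` A \<subseteq> {..<3}"
    by (auto simp: walk_coloring_def split: sum.splits)
  then show ?thesis
    using card_mono[of "{..<3::nat}"] by fastforce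
qed

lemma mod_3_ne_of_distance_le_2:
  fixes x y :: nat
  assumes "x = y + 1 \<or> x = y + 2 \<or> y = x + 1 \<or> y = x + 2"
  shows "x mod 3 \<noteq> y mod 3"
proof -
  have "(m + 1) mod 3 \<noteq> m mod 3" "(m + 2) mod 3 \<noteq> m mod 3" for m :: nat
    by presburger+
  then show ?thesis
    using assms by metis
qed

lemma walk_colors_ne:
  fixes a b c :: nat
  assumes "b = a + 1 \<and> c = a + 2 \<or> b = c + 1 \<and> a = c + 2"
  shows "(a + b) mod 3 \<noteq> (b + c) mod 3" "2 * a mod 3 \<noteq> 2 * b mod 3"
    "2 * b mod 3 \<noteq> (a + b) mod 3" "2 * b mod 3 \<noteq> (b + c) mod 3"
  using assms by (intro mod_3_ne_of_distance_le_2; linarith)+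

lemma total_proper_path_walk_coloring:
  assumes q: "is_path G q"
    and mono: "(\<forall>k. k + 1 < length q \<longrightarrow> pos (q ! (k + 1)) = pos (q ! k) + 1) \<or>
               (\<forall>k. k + 1 < length q \<longrightarrow> pos (q ! k) = pos (q ! (k + 1)) + 1)"
  shows "total_proper_path G (walk_coloring pos) q"
proof -
  have step: "pos (q ! (i + 1)) = pos (q ! i) + 1 \<and> pos (q ! (i + 2)) = pos (q ! i) + 2 \<or>
      pos (q ! (i + 1)) = pos (q ! (i + 2)) + 1 \<and> pos (q ! i) = pos (q ! (i + 2)) + 2"
    if "i + 2 < length q" for i
    using mono
  proof
    assume up: "\<forall>k. k + 1 < length q \<longrightarrow> pos (q ! (k + 1)) = pos (q ! k) + 1"
    show ?thesis
      using that up[rule_format, of i] up[rule_format, of "i + 1"] by simp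
  next
    assume down: "\<forall>k. k + 1 < length q \<longrightarrow> pos (q ! k) = pos (q ! (k + 1)) + 1"
    show ?thesis
      using that down[rule_format, of i] down[rule_format, of "i + 1"] by simp
  qed
  have ne: "q ! i \<noteq> q ! (i + 1)" "q ! (i + 1) \<noteq> q ! (i + 2)" if "i + 2 < length q" for i
    using q that by (auto simp: is_path_def nth_eq_iff_index_eq)
  let ?c = "walk_coloring pos"
  have "?c (Inr {q ! i, q ! (i + 1)}) \<noteq> ?c (Inr {q ! (i + 1), q ! (i + 2)})"
    "?c (Inl (q ! i)) \<noteq> ?c (Inl (q ! (i + 1)))"
    "?c (Inl (q ! (i + 1))) \<noteq> ?c (Inr {q ! i, q ! (i + 1)})"
    "?c (Inl (q ! (i + 1))) \<noteq> ?c (Inr {q ! (i + 1), q ! (i + 2)})"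
    if "i + 2 < length q" for i
    unfolding walk_coloring_Inl walk_coloring_edge[OF ne(1)[OF that]]
      walk_coloring_edge[OF ne(2)[OF that]]
    by (rule walk_colors_ne[OF step[OF that]])+
  then show ?thesis
    using q by (simp add: total_proper_path_def)
qed

text \<open>The segment between two vertices may have to be traversed backwards, depending on which of
  them comes first. What the walk coloring needs is only that positions change by one in a constant
  direction.\<close>

lemma path_segment:
  assumes p: "is_path G p" and i: "i < length p" and j: "j < length p"
    and pos: "\<And>k. k < length p \<Longrightarrow> pos (p ! k) = k"
  shows "\<exists>q. is_path G q \<and> hd q = p ! i \<and> last q = p ! j \<and>
    ((\<forall>k. k + 1 < length q \<longrightarrow> pos (q ! (k + 1)) = pos (q ! k) + 1) \<or>
     (\<forall>k. k + 1 < length q \<longrightarrow> pos (q ! k) = pos (q ! (k + 1)) + 1))"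
proof -
  have E: "{p ! k, p ! (k + 1)} \<in> edges G" if "k + 1 < length p" for k
    using p that by (auto simp: is_path_def)
  have V: "p ! k \<in> verts G" if "k < length p" for k
    using p that by (auto simp: is_path_def)
  have D: "p ! k = p ! l \<longleftrightarrow> k = l" if "k < length p" "l < length p" for k l
    using p that by (auto simp: is_path_def nth_eq_iff_index_eq)
  show ?thesis
  proof (cases "i \<le> j")
    case True
    let ?q = "map (\<lambda>k. p ! (i + k)) [0..<j - i + 1]"
    have "is_path G ?q"
      unfolding is_path_def
      using E V D j True by (auto simp: distinct_map inj_on_def simp del: upt_Suc)
    moreover have "hd ?q = p ! i" "last ?q = p ! j"
      using True by (simp_all add: hd_map last_map del: upt_Suc)
    moreover have "\<forall>k. k + 1 < length ?q \<longrightarrow> pos (?q ! (k + 1)) = pos (?q ! k) + 1"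
      using j pos by (auto simp del: upt_Suc)
    ultimately show ?thesis
      by blast
  next
    case False
    let ?q = "map (\<lambda>k. p ! (i - k)) [0..<i - j + 1]"
    have E': "{p ! (i - k), p ! (i - Suc k)} \<in> edges G" if "k < i - j" for k
      using E[of "i - Suc k"] that i by (simp add: insert_commute Suc_diff_Suc)
    have "is_path G ?q"
      unfolding is_path_def
      using E' V D i False by (auto simp: distinct_map inj_on_def simp del: upt_Suc)
    moreover have "hd ?q = p ! i" "last ?q = p ! j"
      using False by (simp_all add: hd_map last_map del: upt_Suc)
    moreover have "\<forall>k. k + 1 < length ?q \<longrightarrow> pos (?q ! k) = pos (?q ! (k + 1)) + 1"
      using i pos by (auto simp del: upt_Suc)
    ultimately show ?thesis
      by blast
  qed
qed

lemma hamiltonian_path_tpc_le_3: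
  assumes p: "is_path G p" and ham: "set p = verts G"
  shows "connected_graph G" "tpc G \<le> 3"
proof -
  define pos where "pos = the_inv_into {..<length p} ((!) p)"
  have "inj_on ((!) p) {..<length p}"
    using p by (auto simp: is_path_def inj_on_def nth_eq_iff_index_eq)
  then have pos: "pos (p ! k) = k" if "k < length p" for k
    unfolding pos_def using that by (simp add: the_inv_into_f_f)
  have seg: "\<exists>q. is_path G q \<and> hd q = u \<and> last q = v \<and> total_proper_path G (walk_coloring pos) q"
    if "u \<in> verts G" "v \<in> verts G" for u v
  proof -
    obtain i j where ij: "i < length p" "p ! i = u" "j < length p" "p ! j = v"
      using \<open>u \<in> verts G\<close> \<open>v \<in> verts G\<close> unfolding ham[symmetric] in_set_conv_nth by blast
    then show ?thesis
      using path_segment[OF p ij(1,3) pos] total_proper_path_walk_coloring by metis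
  qed
  have "verts G \<noteq> {}"
    using p ham by (auto simp: is_path_def)
  then show "connected_graph G"
    using seg unfolding connected_graph_def by blast
  have "total_proper_connected G (walk_coloring pos)"
    using seg unfolding total_proper_connected_def by blast
  then have "tpc G \<le> card (walk_coloring pos ` (verts G <+> edges G))"
    unfolding tpc_def by (intro Least_le) blast
  also have "\<dots> \<le> 3"
    by (rule card_walk_coloring_image_le)
  finally show "tpc G \<le> 3" .
qed

section \<open>Path graphs and their complements\<close>

definition path_graph :: "nat \<Rightarrow> nat graph" where
  "path_graph n = ({..<n}, {{i, i + 1} |i. i + 1 < n})"

lemma simple_path_graph: "simple_graph (path_graph n)"
  by (auto simp: simple_graph_def path_graph_def)

lemma hamiltonian_path_path_graph:
  assumes "0 < n"
  shows "is_path (path_graph n) [0..<n]" "set [0..<n] = verts (path_graph n)"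
  using assms by (auto simp: is_path_def path_graph_def)

text \<open>The order of visit is 1, 3, 5, \<open>\<dots>\<close>, 0, 2, 4, \<open>\<dots>\<close>.\<close>

definition odd_then_even :: "nat \<Rightarrow> nat \<Rightarrow> nat" where
  "odd_then_even n i = (if i < n div 2 then 2 * i + 1 else 2 * (i - n div 2))"

lemma hamiltonian_path_complement_path_graph:
  assumes n: "4 \<le> n"
  shows "is_path (complement (path_graph n)) (map (odd_then_even n) [0..<n])"
    and "set (map (odd_then_even n) [0..<n]) = verts (complement (path_graph n))"
proof -
  let ?f = "odd_then_even n"
  have inj: "inj_on ?f {..<n}"
    by (rule inj_onI) (auto simp: odd_then_even_def split: if_splits; presburger)
  have bound: "?f i < n" if "i < n" for i
    using that by (auto simp: odd_then_even_def)
  have "?f ` {..<n} = {..<n}"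
    using bound by (intro endo_inj_surj[OF _ _ inj]) auto
  then show all: "set (map ?f [0..<n]) = verts (complement (path_graph n))"
    by (simp add: complement_def path_graph_def atLeast0LessThan)
  have "{?f i, ?f (i + 1)} \<in> edges (complement (path_graph n))" if i: "i + 1 < n" for i
  proof -
    have "?f i \<noteq> ?f (i + 1)"
      using inj_onD[OF inj, of i "i + 1"] i by auto
    \<comment> \<open>The first inequality can only fail at the jump from the largest odd vertex to 0, where
      \<open>4 \<le> n\<close> makes that odd vertex at least 3.\<close>
    moreover have "?f i \<noteq> ?f (i + 1) + 1" "?f (i + 1) \<noteq> ?f i + 1"
      using n i by (auto simp: odd_then_even_def)
    ultimately show ?thesis
      using bound i by (auto simp: complement_def path_graph_def doubleton_eq_iff)
  qed
  moreover have "distinct (map ?f [0..<n])"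
    using inj by (simp add: distinct_map atLeast0LessThan)
  ultimately show "is_path (complement (path_graph n)) (map ?f [0..<n])"
    using n all by (simp add: is_path_def)
qed

theorem theorem6:
  "(\<forall>G :: 'a graph.
      simple_graph G \<and> card (verts G) \<ge> 4 \<and>
      connected_graph G \<and> connected_graph (complement G) \<longrightarrow>
      tpc G + tpc (complement G) \<ge> 6) \<and>
   (\<forall>n::nat. n \<ge> 4 \<longrightarrow>
      (\<exists>G :: nat graph.
         simple_graph G \<and> card (verts G) = n \<and>
         connected_graph G \<and> connected_graph (complement G) \<and>
         tpc G + tpc (complement G) = 6))"
proof (intro conjI allI impI)
  fix G :: "'a graph"
  assume "simple_graph G \<and> card (verts G) \<ge> 4 \<and>
    connected_graph G \<and> connected_graph (complement G)"
  then show "6 \<le> tpc G + tpc (complement G)"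
    using tpc_and_complement_ge_3[of G] by simp
next
  fix n :: nat
  assume n: "4 \<le> n"
  let ?G = "path_graph n"
  have card: "card (verts ?G) = n"
    by (simp add: path_graph_def)
  have G: "connected_graph ?G" "tpc ?G \<le> 3"
    using hamiltonian_path_tpc_le_3[OF hamiltonian_path_path_graph] n by simp_all
  have G': "connected_graph (complement ?G)" "tpc (complement ?G) \<le> 3"
    using hamiltonian_path_tpc_le_3[OF hamiltonian_path_complement_path_graph[OF n]] by simp_all
  have "tpc ?G + tpc (complement ?G) = 6"
    using tpc_and_complement_ge_3[OF simple_path_graph G(1) G'(1)] G G' n card by simp
  then show "\<exists>G :: nat graph. simple_graph G \<and> card (verts G) = n \<and>
      connected_graph G \<and> connected_graph (complement G) \<and> tpc G + tpc (complement G) = 6"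
    using simple_path_graph card G(1) G'(1) by blast
qed

end
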